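(* Let $K$ be a field and $R=K[x,y,z,u,v]$ a polynomial ring in five variables. There is a monomial ideal $I$ in $R$ such that neither $\operatorname{assrad}(I^{(s)})$ nor $\operatorname{assrad}(I^s)$ is constant for $s\gg 0$; that is, there is no integer $s_0\ge 1$ such that $\operatorname{assrad}(I^{(s)})=\operatorname{assrad}(I^{(s_0)})$ for all $s\ge s_0$, and there is no integer $s_0\ge 1$ such that $\operatorname{assrad}(I^{s})=\operatorname{assrad}(I^{s_0})$ for all $s\ge s_0$.
   Context: For a monomial ideal $I$ of a polynomial ring $R$ over a field, $\operatorname{assrad}(I)=\{\sqrt{I:f}\mid f \text{ is a monomial of } R,\ f\notin I\}$ denotes the set of associated radical ideals of $I$. For $s\ge 1$ the $s$-th symbolic power of $I$ is $I^{(s)}=\bigcap_{\mathfrak p\in \operatorname{Min}(I)} (I^sR_{\mathfrak p}\cap R)$, where $\operatorname{Min}(I)$ is the set of minimal primes of $I$. *)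

theory Defs
  imports
    "HOL-Algebra.Algebraic_Closure_Type"
    "HOL-Algebra.Ideal_Product"
    "HOL-Computational_Algebra.Fraction_Field"
    "HOL-Library.Poly_Mapping"
    "HOL-Library.Numeral_Type"
begin

text \<open>
  The polynomial ring over a field \<open>'k\<close> in variables indexed by a linearly ordered type \<open>'x\<close>
  is the type \<open>('x \<Rightarrow>\<^sub>0 nat) \<Rightarrow>\<^sub>0 'k\<close>: finitely supported functions from exponent vectors to
  coefficients, with convolution as multiplication. The order on \<open>'x\<close> is only needed for the
  \<open>idom\<close> instance. Ideals of a type-class ring are taken in the sense of HOL-Algebra via
  \<^const>\<open>ring_of_type_algebra\<close>.
\<close>

type_synonym ('x, 'k) mpoly = "('x \<Rightarrow>\<^sub>0 nat) \<Rightarrow>\<^sub>0 'k"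

abbreviation type_ring :: "'a::comm_ring_1 ring"
  where "type_ring \<equiv> ring_of_type_algebra"


subsection \<open>Ideals\<close>

definition ideal_power :: "'a::comm_ring_1 set \<Rightarrow> nat \<Rightarrow> 'a set"
  where "ideal_power I s = I [^]\<^bsub>ideals_set type_ring\<^esub> s"

definition radical :: "'a::comm_ring_1 set \<Rightarrow> 'a set"
  where "radical I = {g. \<exists>n>0. g ^ n \<in> I}"

definition colon :: "'a::comm_ring_1 set \<Rightarrow> 'a \<Rightarrow> 'a set"
  where "colon I f = {g. g * f \<in> I}"

definition minimal_primes :: "'a::comm_ring_1 set \<Rightarrow> 'a set set"
  where "minimal_primes I =
    {P. primeideal P type_ring \<and> I \<subseteq> P \<and>
        (\<forall>Q. primeideal Q type_ring \<and> I \<subseteq> Q \<and> Q \<subseteq> P \<longrightarrow> Q = P)}"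


subsection \<open>Localization and symbolic powers\<close>

text \<open>
  The localization of a domain at a prime ideal \<open>P\<close>, as a subring of the fraction field.
  Since \<open>0 \<in> P\<close>, the denominators \<open>b \<notin> P\<close> are nonzero.
\<close>

definition localization :: "'a::idom set \<Rightarrow> 'a fract ring"
  where "localization P = type_ring \<lparr>carrier := {Fract a b | a b. b \<notin> P}\<rparr>"

definition extension :: "'a::idom set \<Rightarrow> 'a set \<Rightarrow> 'a fract set"
  where "extension P J = Idl\<^bsub>localization P\<^esub> ((\<lambda>a. Fract a 1) ` J)"

definition contraction :: "'a::idom fract set \<Rightarrow> 'a set"
  where "contraction L = {a. Fract a 1 \<in> L}"

definition symbolic_power :: "'a::idom set \<Rightarrow> nat \<Rightarrow> 'a set"
  where "symbolic_power I s =
    (\<Inter>P\<in>minimal_primes I. contraction (extension P (ideal_power I s)))"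

lemma cring_localization:
  fixes P :: "'a::idom set"
  assumes "primeideal P type_ring"
  shows "cring (localization P)"
proof -
  interpret F: cring "type_ring :: 'a fract ring" ..
  interpret P: primeideal P type_ring by fact
  have one: "1 \<notin> P"
    using P.one_imp_carrier P.I_notcarr by (auto simp: ring_of_type_algebra_def)
  have zero: "0 \<in> P"
    using additive_subgroup.zero_closed[OF P.is_additive_subgroup] by (simp add: ring_of_type_algebra_def)
  have mult: "b * d \<notin> P" if "b \<notin> P" "d \<notin> P" for b d
    using P.I_prime[of b d] that by (auto simp: ring_of_type_algebra_def)
  let ?C = "{Fract a b | a b. b \<notin> P}"
  have add_closed: "x + y \<in> ?C" if xy: "x \<in> ?C" "y \<in> ?C" for x y
  proof -
    obtain a b c d where ab: "x = Fract a b" "b \<notin> P" "y = Fract c d" "d \<notin> P"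
      using xy by blast
    with zero ab have "b \<noteq> 0" "d \<noteq> 0" by auto
    with ab show ?thesis using mult by auto
  qed
  have mult_closed: "x * y \<in> ?C" if "x \<in> ?C" "y \<in> ?C" for x y
    using that mult by fastforce
  have minus_closed: "- x \<in> ?C" if "x \<in> ?C" for x
    using that by force
  have C01: "0 \<in> ?C" "1 \<in> ?C"
    using one by (auto simp: Zero_fract_def One_fract_def)
  show ?thesis
    unfolding localization_def ring_of_type_algebra_def
  proof (rule cringI)
    show "abelian_group
        (\<lparr>carrier = UNIV, monoid.mult = (*), one = 1, ring.zero = 0, add = (+)\<rparr>\<lparr>carrier := ?C\<rparr>)"
    proof (rule abelian_groupI, goal_cases)
      case (6 x)
      then have "- x \<in> ?C" using minus_closed by simp
      then show ?case by (intro bexI[of _ "- x"]) simp_all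
    qed (use add_closed C01 in \<open>simp_all add: add_ac\<close>)
    show "Group.comm_monoid
        (\<lparr>carrier = UNIV, monoid.mult = (*), one = 1, ring.zero = 0, add = (+)\<rparr>\<lparr>carrier := ?C\<rparr>)"
      by (rule comm_monoidI) (use mult_closed C01 in \<open>auto simp: mult_ac\<close>)
  qed (auto simp: distrib_right)
qed


subsection \<open>Monomial ideals and associated radicals\<close>

definition monomials :: "('x::linorder, 'k::field) mpoly set"
  where "monomials = range (\<lambda>m. Poly_Mapping.single m 1)"

definition monomial_ideal :: "('x::linorder, 'k::field) mpoly set \<Rightarrow> bool"
  where "monomial_ideal I \<longleftrightarrow> (\<exists>S \<subseteq> monomials. I = Idl\<^bsub>type_ring\<^esub> S)"

definition assrad :: "('x::linorder, 'k::field) mpoly set \<Rightarrow> ('x, 'k) mpoly set set"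
  where "assrad I = {radical (colon I f) | f. f \<in> monomials \<and> f \<notin> I}"

end

theory Submission
  imports Defs
begin

text \<open>
  The ideal is \<open>I = (x^4, y^4) \<inter> (z^2, u) \<inter> (x, z)^4 \<inter> (y, z)^4\<close> for any four distinct variables
  \<open>x, y, z, u\<close>. The radical ideal that appears in \<open>assrad\<close> exactly for odd \<open>s\<close> is
  \<open>T = (x, y) \<inter> (z, u) = (xz, xu, yz, yu)\<close>.

  Localizing \<open>I\<close> at one of its four minimal primes leaves only the component belonging to that prime,
  and a monomial lies in the \<open>s\<close>-th power of a component iff the corresponding function \<open>ord_xy\<close>,
  \<open>ord_zu\<close>, \<open>ord_xz\<close> or \<open>ord_yz\<close> of its exponents is at least \<open>s\<close>. Inverting \<open>x\<close> and \<open>u\<close>, or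
  \<open>y\<close> and \<open>u\<close>, also leaves a single component, \<open>(y, z)^4\<close> and \<open>(x, z)^4\<close> respectively, while
  inverting \<open>x, z\<close> or \<open>y, z\<close> leaves the unit ideal. Hence \<open>T\<close> is the radical of the colon ideal of a
  monomial \<open>f\<close> iff \<open>f\<close> lies in the powers of the components \<open>(x, z)^4\<close> and \<open>(y, z)^4\<close> and outside
  those of \<open>(x^4, y^4)\<close> and \<open>(z^2, u)\<close>. This criterion is the same for ordinary and for symbolic
  powers, since only localizations of the power enter.

  The criterion depends on parity: \<open>f\<close> outside the power of \<open>(z^2, u)\<close> has \<open>z\<close>-exponent at most
  \<open>2 s - 1\<close>, so its \<open>x\<close>- and \<open>y\<close>-exponents are at least \<open>2 s + 1\<close>. For even \<open>s\<close> this forces \<open>f\<close>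
  into \<open>(x^4, y^4)^s\<close>; for odd \<open>s\<close> the exponent \<open>2 s + 1\<close> is \<open>3\<close> modulo \<open>4\<close>, both roundings lose
  enough, and \<open>f = x^(2s+1) y^(2s+1) z^(2s-1)\<close> escapes. Here the failure of \<open>(x^4, y^4)\<close> to be
  integrally closed is essential.

  The two directions are \<open>osc_radical_in_assrad\<close> and \<open>osc_radical_notin_assrad\<close>. They use an upper
  bound for the power that may be tested after localization (\<open>ord_bound_of_product\<close>) and a supply of
  monomials inside the power (\<open>xpow_in_osc_power\<close>).
\<close>

section \<open>Ideals of a type-class ring\<close>

lemma type_ring_simps [simp]:
  "carrier type_ring = UNIV" "monoid.mult type_ring = (*)" "monoid.one type_ring = 1"
  "ring.zero type_ring = 0" "add type_ring = (+)"
  by (simp_all add: ring_of_type_algebra_def)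

lemma ideal_type_ringI:
  fixes J :: "'a::comm_ring_1 set"
  assumes "0 \<in> J" "\<And>a b. a \<in> J \<Longrightarrow> b \<in> J \<Longrightarrow> a + b \<in> J" "\<And>r a. a \<in> J \<Longrightarrow> r * a \<in> J"
  shows "ideal J type_ring"
proof -
  interpret cring "type_ring :: 'a ring" ..
  have neg: "\<ominus>\<^bsub>type_ring\<^esub> a = - a" for a :: 'a
    by (rule minus_equality) simp_all
  have closed: "- a \<in> J" if "a \<in> J" for a
    using assms(3)[OF that, of "- 1"] by simp
  show ?thesis
  proof (rule idealI)
    show "subgroup J (add_monoid type_ring)"
      using assms closed by (intro add.subgroupI) (auto simp: neg a_inv_def[symmetric])
  qed (use assms in \<open>auto simp: mult.commute intro: ring_axioms\<close>)
qed

lemma ideal_type_ringD: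
  fixes J :: "'a::comm_ring_1 set"
  assumes "ideal J type_ring"
  shows "0 \<in> J" "a \<in> J \<Longrightarrow> b \<in> J \<Longrightarrow> a + b \<in> J" "a \<in> J \<Longrightarrow> r * a \<in> J"
proof -
  interpret ideal J type_ring by fact
  show "0 \<in> J" "a \<in> J \<Longrightarrow> b \<in> J \<Longrightarrow> a + b \<in> J" "a \<in> J \<Longrightarrow> r * a \<in> J"
    using additive_subgroup.zero_closed[OF is_additive_subgroup]
      additive_subgroup.a_closed[OF is_additive_subgroup] I_l_closed by auto
qed

lemma primeideal_type_ring_pow:
  fixes P :: "'a::comm_ring_1 set"
  assumes "primeideal P type_ring" "a ^ n \<in> P"
  shows "a \<in> P"
proof -
  interpret primeideal P type_ring by fact
  have "1 \<notin> P" using one_imp_carrier I_notcarr by auto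
  then show ?thesis using assms(2)
    by (induction n) (use I_prime in auto)
qed

lemma ideal_power_0: "ideal_power I 0 = (UNIV :: 'a::comm_ring_1 set)"
  by (simp add: ideal_power_def ideals_set_def nat_pow_def)

lemma ideal_power_Suc:
  "ideal_power I (Suc n) = ideal_prod type_ring (ideal_power I n) (I :: 'a::comm_ring_1 set)"
  by (simp add: ideal_power_def ideals_set_def nat_pow_def)

lemma ideal_ideal_power:
  fixes I :: "'a::comm_ring_1 set"
  assumes "ideal I type_ring"
  shows "ideal (ideal_power I n) type_ring"
proof -
  interpret cring "type_ring :: 'a ring" ..
  show ?thesis
    using oneideal by (induction n) (auto simp: ideal_power_0 ideal_power_Suc assms intro: ideal_prod_is_ideal)
qed

text \<open>
  The fractions with numerator in \<open>J\<close> already form an ideal of the localization, so an element of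
  the contracted extension is a multiple of an element of \<open>J\<close> up to one denominator.
\<close>
lemma contraction_extensionD:
  fixes P J :: "'a::idom set"
  assumes P: "primeideal P type_ring" and J: "ideal J type_ring"
    and a: "a \<in> contraction (extension P J)"
  obtains b where "b \<notin> P" "b * a \<in> J"
proof -
  interpret P: primeideal P type_ring by fact
  interpret L: cring "localization P" using cring_localization[OF P] .
  note Jc = ideal_type_ringD[OF J]
  have one: "1 \<notin> P" using P.one_imp_carrier P.I_notcarr by auto
  have zero: "0 \<in> P" using ideal_type_ringD(1)[OF P.ideal_axioms] .
  have mult: "b * d \<notin> P" if "b \<notin> P" "d \<notin> P" for b d
    using P.I_prime[of b d] that by auto
  let ?L = "{Fract a b | a b. a \<in> J \<and> b \<notin> P}"
  have car: "carrier (localization P) = {Fract a b | a b. b \<notin> P}"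
    and ops [simp]: "add (localization P) = (+)" "monoid.mult (localization P) = (*)"
      "ring.zero (localization P) = 0" "monoid.one (localization P) = 1"
    by (simp_all add: localization_def ring_of_type_algebra_def)
  have add: "p + q \<in> ?L" if pq: "p \<in> ?L" "q \<in> ?L" for p q
  proof -
    obtain a b c d where "p = Fract a b" "q = Fract c d" "a \<in> J" "c \<in> J" "b \<notin> P" "d \<notin> P"
      using pq by blast
    moreover from this zero have "b \<noteq> 0" "d \<noteq> 0" by auto
    moreover have "a * d + c * b \<in> J" using Jc(2)[OF Jc(3)[of a d] Jc(3)[of c b]] calculation by (simp add: mult.commute)
    ultimately show ?thesis using mult by auto
  qed
  have neg: "- p \<in> ?L" if p: "p \<in> ?L" for p
  proof -
    obtain a b where "p = Fract a b" "a \<in> J" "b \<notin> P" using p by blast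
    moreover have "- a \<in> J" using Jc(3)[of a "- 1"] \<open>a \<in> J\<close> by simp
    ultimately show ?thesis by auto
  qed
  have lmult: "q * p \<in> ?L" if p: "p \<in> ?L" and q: "q \<in> carrier (localization P)" for p q
  proof -
    obtain a b c d where "p = Fract a b" "q = Fract c d" "a \<in> J" "b \<notin> P" "d \<notin> P"
      using p q car by blast
    moreover have "c * a \<in> J" using Jc calculation by simp
    ultimately show ?thesis using mult by auto
  qed
  have L0: "0 \<in> ?L" using Jc(1) one by (auto simp: Zero_fract_def)
  have sub: "?L \<subseteq> carrier (localization P)" using car by blast
  have neg_eq: "\<ominus>\<^bsub>localization P\<^esub> p = - p" if "p \<in> ?L" for p
    by (rule L.minus_equality) (use that sub neg in auto)
  have "ideal ?L (localization P)"
  proof (rule idealI)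
    show "subgroup ?L (add_monoid (localization P))"
      using L0 sub add neg by (intro L.add.subgroupI) (auto simp del: minus_fract simp: neg_eq a_inv_def[symmetric])
  next
    fix p q assume "p \<in> ?L" "q \<in> carrier (localization P)"
    then show "q \<otimes>\<^bsub>localization P\<^esub> p \<in> ?L" "p \<otimes>\<^bsub>localization P\<^esub> q \<in> ?L"
      using lmult[of p q] unfolding ops by (auto simp only: mult.commute[of p q])
  qed (rule L.ring_axioms)
  moreover have "(\<lambda>a. Fract a 1) ` J \<subseteq> ?L" using one by auto
  ultimately have "extension P J \<subseteq> ?L"
    unfolding extension_def by (rule L.genideal_minimal)
  then have "Fract a 1 \<in> ?L" using a by (auto simp: contraction_def)
  then obtain c b where "Fract a 1 = Fract c b" "c \<in> J" "b \<notin> P" by blast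
  moreover from this zero have "b \<noteq> 0" by auto
  ultimately have "b * a \<in> J" by (simp add: eq_fract mult.commute)
  with \<open>b \<notin> P\<close> show thesis by (rule that)
qed

lemma subset_contraction_extension:
  fixes P J :: "'a::idom set"
  assumes "primeideal P type_ring"
  shows "J \<subseteq> contraction (extension P J)"
proof -
  interpret P: primeideal P type_ring by fact
  interpret L: cring "localization P" using cring_localization[OF assms] .
  have "1 \<notin> P" using P.one_imp_carrier P.I_notcarr by auto
  then have "(\<lambda>a. Fract a 1) ` J \<subseteq> carrier (localization P)"
    by (auto simp: localization_def)
  then show ?thesis
    unfolding extension_def contraction_def using L.genideal_self by auto
qed

lemma ideal_power_subset_symbolic_power: "ideal_power I s \<subseteq> symbolic_power I s"
  unfolding symbolic_power_def minimal_primes_def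
  using subset_contraction_extension by fastforce

lemma symbolic_powerD:
  assumes "ideal I type_ring" "P \<in> minimal_primes I" "a \<in> symbolic_power I s"
  obtains b where "b \<notin> P" "b * a \<in> ideal_power I s"
  using contraction_extensionD[of P "ideal_power I s" a] assms ideal_ideal_power[of I s]
  unfolding symbolic_power_def minimal_primes_def by blast

section \<open>Polynomials with prescribed exponents\<close>

abbreviation exponents :: "('x, 'k::zero) mpoly \<Rightarrow> ('x \<Rightarrow>\<^sub>0 nat) set"
  where "exponents \<equiv> Poly_Mapping.keys"

abbreviation xpow :: "('x \<Rightarrow>\<^sub>0 nat) \<Rightarrow> ('x, 'k::zero_neq_one) mpoly"
  where "xpow m \<equiv> Poly_Mapping.single m 1"

abbreviation expo :: "('x \<Rightarrow>\<^sub>0 nat) \<Rightarrow> 'x \<Rightarrow> nat"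
  where "expo \<equiv> Poly_Mapping.lookup"

definition supported :: "('x \<Rightarrow>\<^sub>0 nat) set \<Rightarrow> ('x::linorder, 'k::field) mpoly set"
  where "supported U = {g. exponents g \<subseteq> U}"

lemma sum_of_terms: "g = (\<Sum>k\<in>Poly_Mapping.keys g. Poly_Mapping.single k (Poly_Mapping.lookup g k))"
  by (rule poly_mapping_eqI)
    (auto simp: lookup_sum lookup_single when_def sum.delta' in_keys_iff)

lemma lookup_mult_xpow:
  fixes g :: "('x::linorder, 'k::field) mpoly"
  shows "Poly_Mapping.lookup (g * xpow m) (k + m) = Poly_Mapping.lookup g k"
proof -
  have "g * xpow m = (\<Sum>l\<in>exponents g. Poly_Mapping.single (l + m) (Poly_Mapping.lookup g l))"
    by (subst sum_of_terms[of g]) (simp add: sum_distrib_right mult_single)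
  then show ?thesis
    by (auto simp: lookup_sum lookup_single when_def sum.delta' in_keys_iff)
qed

lemma ideal_supported:
  assumes up: "\<And>m n. m \<in> U \<Longrightarrow> n + m \<in> U"
  shows "ideal (supported U :: ('x::linorder, 'k::field) mpoly set) type_ring"
proof (rule ideal_type_ringI)
  fix r a :: "('x, 'k) mpoly" assume "a \<in> supported U"
  then show "r * a \<in> supported U"
    using keys_mult[of r a] up unfolding supported_def by blast
next
  fix a b :: "('x, 'k) mpoly" assume "a \<in> supported U" "b \<in> supported U"
  then show "a + b \<in> supported U"
    using keys_add[of a b] unfolding supported_def by blast
qed (simp add: supported_def)

lemma terms_in_ideal:
  fixes J :: "('x::linorder, 'k::field) mpoly set"
  assumes J: "ideal J type_ring" and g: "\<And>m. m \<in> exponents g \<Longrightarrow> xpow m \<in> J"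
  shows "g \<in> J"
proof -
  note Jc = ideal_type_ringD[OF J]
  have t: "Poly_Mapping.single k (Poly_Mapping.lookup g k) \<in> J" if "k \<in> exponents g" for k
    using Jc(3)[OF g[OF that], of "Poly_Mapping.single 0 (Poly_Mapping.lookup g k)"]
    by (simp add: mult_single)
  have "sum (\<lambda>k. Poly_Mapping.single k (Poly_Mapping.lookup g k)) A \<in> J"
    if "A \<subseteq> exponents g" "finite A" for A
    using that(2,1)
  proof (induction A rule: finite_induct)
    case empty
    show ?case using Jc(1) by simp
  next
    case (insert k A)
    then have "Poly_Mapping.single k (Poly_Mapping.lookup g k) \<in> J"
      "sum (\<lambda>k. Poly_Mapping.single k (Poly_Mapping.lookup g k)) A \<in> J"
      using t by simp_all
    with insert.hyps show ?case by (simp add: Jc(2))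
  qed
  from this[OF subset_refl finite_keys] show ?thesis
    by (subst sum_of_terms[of g])
qed

lemma monomial_ideal_supported:
  assumes up: "\<And>m n. m \<in> U \<Longrightarrow> n + m \<in> U"
  shows "monomial_ideal (supported U :: ('x::linorder, 'k::field) mpoly set)"
  unfolding monomial_ideal_def
proof (intro exI conjI)
  interpret cring "type_ring :: ('x, 'k) mpoly ring" ..
  let ?S = "xpow ` U :: ('x, 'k) mpoly set"
  show "?S \<subseteq> monomials" by (auto simp: monomials_def)
  show "supported U = Idl\<^bsub>type_ring\<^esub> ?S"
  proof
    show "Idl\<^bsub>type_ring\<^esub> ?S \<subseteq> supported U"
      by (rule genideal_minimal[OF ideal_supported]) (auto simp: supported_def up)
    show "supported U \<subseteq> Idl\<^bsub>type_ring\<^esub> ?S"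
    proof
      fix g :: "('x, 'k) mpoly" assume "g \<in> supported U"
      then show "g \<in> Idl\<^bsub>type_ring\<^esub> ?S"
        using genideal_self[of ?S]
        by - (rule terms_in_ideal[OF genideal_ideal[of ?S]], auto simp: supported_def)
    qed
  qed
qed

text \<open>
  Superadditive functions on exponents are the common form of membership tests for powers: a product
  of \<open>s\<close> monomials of weight at least \<open>1\<close> has weight at least \<open>s\<close>.
\<close>
definition superadditive :: "(('x \<Rightarrow>\<^sub>0 nat) \<Rightarrow> nat) \<Rightarrow> bool"
  where "superadditive \<phi> \<longleftrightarrow> (\<forall>a b. \<phi> a + \<phi> b \<le> \<phi> (a + b))"

lemma superadditive_mono:
  assumes "superadditive \<phi>" shows "\<phi> a \<le> \<phi> (a + b)"
  using assms add_leD1 unfolding superadditive_def by blast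

lemma ideal_power_supported_subset:
  fixes I :: "('x::linorder, 'k::field) mpoly set"
  assumes sup: "superadditive \<phi>" and I: "I \<subseteq> supported {m. 1 \<le> \<phi> m}"
  shows "ideal_power I s \<subseteq> supported {m. s \<le> \<phi> m}"
proof (induction s)
  case 0 then show ?case by (simp add: supported_def)
next
  case (Suc s)
  show ?case
  proof
    fix g assume "g \<in> ideal_power I (Suc s)"
    then have "g \<in> ideal_prod type_ring (ideal_power I s) I" by (simp add: ideal_power_Suc)
    then show "g \<in> supported {m. Suc s \<le> \<phi> m}"
    proof (induction g)
      case (prod i j)
      have "Suc s \<le> \<phi> (a + b)" if "a \<in> exponents i" "b \<in> exponents j" for a b
      proof -
        have "s \<le> \<phi> a" "1 \<le> \<phi> b" using that prod Suc.IH I by (auto simp: supported_def)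
        moreover have "\<phi> a + \<phi> b \<le> \<phi> (a + b)" using sup by (simp add: superadditive_def)
        ultimately show ?thesis by linarith
      qed
      then show ?case using keys_mult[of i j] by (auto simp: supported_def)
    next
      case (sum g h)
      then show ?case using keys_add[of g h] by (auto simp: supported_def)
    qed
  qed
qed

lemma power_exponents:
  fixes g :: "('x::linorder, 'k::field) mpoly"
  assumes sup: "superadditive \<phi>" and g: "\<And>m. m \<in> exponents g \<Longrightarrow> 1 \<le> \<phi> m"
    and "m \<in> exponents (g ^ n)"
  shows "n \<le> \<phi> m"
  using assms(3)
proof (induction n arbitrary: m)
  case (Suc n)
  then obtain a b where m: "m = a + b" "a \<in> exponents g" "b \<in> exponents (g ^ n)"
    using keys_mult[of g "g ^ n"] by auto
  have "\<phi> a + \<phi> b \<le> \<phi> (a + b)" using sup by (simp add: superadditive_def)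
  then show ?case using g[OF m(2)] Suc.IH[OF m(3)] unfolding m(1) by linarith
qed simp

text \<open>
  A converse to \<open>ideal_power_supported_subset\<close>, up to a factor: a monomial of weight \<open>s\<close> splits into \<open>s\<close> pieces from
  \<open>A\<close>, and each piece enters \<open>I\<close> after multiplication by \<open>p^4 q^4\<close>. The factor plays the part of a unit
  in the ring where the variables \<open>p\<close> and \<open>q\<close> are inverted.
\<close>
lemma xpow_in_ideal_power:
  fixes I :: "('x::linorder, 'k::field) mpoly set"
  assumes I: "ideal I type_ring"
    and split: "\<And>m n. Suc n \<le> \<phi> m \<Longrightarrow> \<exists>a b. m = a + b \<and> a \<in> A \<and> n \<le> \<phi> b"
    and A: "\<And>a. a \<in> A \<Longrightarrow> xpow (a + (Poly_Mapping.single p 4 + Poly_Mapping.single q 4)) \<in> I"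
    and m: "s \<le> \<phi> m"
  shows "xpow (m + (Poly_Mapping.single p (4 * s) + Poly_Mapping.single q (4 * s)))
    \<in> ideal_power I s"
  using m
proof (induction s arbitrary: m)
  case 0 then show ?case by (simp add: ideal_power_0)
next
  case (Suc s)
  let ?w = "\<lambda>k. Poly_Mapping.single p (4 * k) + Poly_Mapping.single q (4 * k)"
  obtain a b where m: "m = a + b" "a \<in> A" "s \<le> \<phi> b" using split[OF Suc.prems] by blast
  have "xpow (b + ?w s) * xpow (a + ?w 1) \<in> ideal_power I (Suc s)"
    using ideal_prod.prod[OF Suc.IH[OF m(3)] A[OF m(2)], of type_ring]
    by (simp add: ideal_power_Suc)
  moreover have "(b + ?w s) + (a + ?w 1) = m + ?w (Suc s)"
    by (simp add: m(1) single_add algebra_simps)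
  ultimately show ?case by (simp add: mult_single)
qed

section \<open>Primes generated by variables\<close>

definition var_ideal :: "'x set \<Rightarrow> ('x::linorder, 'k::field) mpoly set"
  where "var_ideal V = supported {m. \<exists>i\<in>V. expo m i \<noteq> 0}"

lemma var_ideal_iff: "g \<in> var_ideal V \<longleftrightarrow> (\<forall>m\<in>exponents g. \<exists>i\<in>V. expo m i \<noteq> 0)"
  by (auto simp: var_ideal_def supported_def)

lemma xpow_in_var_ideal_iff: "xpow m \<in> var_ideal V \<longleftrightarrow> (\<exists>i\<in>V. expo m i \<noteq> 0)"
  by (simp add: var_ideal_iff)

lemma ideal_var_ideal: "ideal (var_ideal V) type_ring"
  unfolding var_ideal_def by (rule ideal_supported) (auto simp: lookup_add)

text \<open>
  Modulo the ideal, a polynomial is its part \<open>g0\<close> free of the variables in \<open>V\<close>, and such parts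
  multiply to a nonzero polynomial of the same kind because the polynomial ring is a domain.
\<close>
lemma primeideal_var_ideal:
  "primeideal (var_ideal V :: ('x::linorder, 'k::field) mpoly set) type_ring"
proof (rule primeidealI)
  let ?P = "var_ideal V :: ('x, 'k) mpoly set"
  note c = ideal_type_ringD[OF ideal_var_ideal[of V]]
  have "(1 :: ('x, 'k) mpoly) \<notin> ?P" by (simp add: var_ideal_iff)
  then show "carrier type_ring \<noteq> ?P" by auto
  have split: "\<exists>g0 g1. g = g0 + g1 \<and> g0 \<noteq> 0 \<and> g1 \<in> ?P \<and> (\<forall>m\<in>exponents g0. \<forall>i\<in>V. expo m i = 0)"
    if g: "g \<notin> ?P" for g
  proof -
    let ?A = "{k. \<forall>i\<in>V. expo k i = 0}"
    define part where
      "part C = (\<Sum>k\<in>exponents g \<inter> C. Poly_Mapping.single k (Poly_Mapping.lookup g k))" for C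
    have part: "Poly_Mapping.lookup (part C) k = (if k \<in> C then Poly_Mapping.lookup g k else 0)" for C k
      by (auto simp: part_def lookup_sum lookup_single when_def sum.delta' in_keys_iff)
    have keys: "k \<in> exponents (part C) \<longleftrightarrow> k \<in> exponents g \<and> k \<in> C" for C k
      by (simp add: in_keys_iff part)
    have "g = part ?A + part (- ?A)"
      by (rule poly_mapping_eqI) (simp add: lookup_add part)
    moreover have "part ?A \<noteq> 0"
    proof -
      obtain k where "k \<in> exponents g" "k \<in> ?A" using g by (auto simp: var_ideal_iff)
      then have "k \<in> exponents (part ?A)" by (simp add: keys)
      then show ?thesis by auto
    qed
    moreover have "part (- ?A) \<in> ?P" by (auto simp: var_ideal_iff keys)
    moreover have "\<forall>m\<in>exponents (part ?A). \<forall>i\<in>V. expo m i = 0" by (auto simp: keys)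
    ultimately show ?thesis by blast
  qed
  fix g h :: "('x, 'k) mpoly"
  assume gh: "g \<otimes>\<^bsub>type_ring\<^esub> h \<in> ?P"
  show "g \<in> ?P \<or> h \<in> ?P"
  proof (rule ccontr)
    assume "\<not> ?thesis"
    then obtain g0 g1 h0 h1 where
      g: "g = g0 + g1" "g0 \<noteq> 0" "g1 \<in> ?P" "\<forall>m\<in>exponents g0. \<forall>i\<in>V. expo m i = 0" and
      h: "h = h0 + h1" "h0 \<noteq> 0" "h1 \<in> ?P" "\<forall>m\<in>exponents h0. \<forall>i\<in>V. expo m i = 0"
      using split[of g] split[of h] by blast
    have "g0 * h0 = g * h + (- 1) * (g0 * h1 + h * g1)"
      unfolding g(1) h(1) by (simp add: algebra_simps)
    moreover have "g * h \<in> ?P" using gh by simp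
    then have "g * h + (- 1) * (g0 * h1 + h * g1) \<in> ?P"
      by (rule c(2)[OF _ c(3)[OF c(2)[OF c(3)[OF h(3)] c(3)[OF g(3)]]]])
    ultimately have "g0 * h0 \<in> ?P" by simp
    moreover obtain k where "k \<in> exponents (g0 * h0)"
      using g(2) h(2) no_zero_divisors[of g0 h0] keys_eq_empty[of "g0 * h0"] by blast
    moreover from this have "\<forall>i\<in>V. expo k i = 0"
      using keys_mult[of g0 h0] g(4) h(4) by (fastforce simp: lookup_add)
    ultimately show False by (auto simp: var_ideal_iff)
  qed
qed (auto intro: ideal_var_ideal)

text \<open>
  A prime between \<open>I\<close> and the variable ideal contains a power of each variable times an element
  it avoids, hence contains each variable.
\<close>
lemma var_ideal_minimal_prime:
  fixes I :: "('x::linorder, 'k::field) mpoly set"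
  assumes I: "I \<subseteq> var_ideal V"
    and pow: "\<And>i. i \<in> V \<Longrightarrow> \<exists>n b. b \<notin> var_ideal V \<and> xpow (Poly_Mapping.single i 1) ^ n * b \<in> I"
  shows "var_ideal V \<in> minimal_primes I"
  unfolding minimal_primes_def
proof (intro CollectI conjI allI impI)
  fix Q assume Q: "primeideal Q type_ring \<and> I \<subseteq> Q \<and> Q \<subseteq> var_ideal V"
  then interpret Q: primeideal Q type_ring by simp
  note c = ideal_type_ringD[OF Q.ideal_axioms]
  have var: "xpow (Poly_Mapping.single i 1) \<in> Q" if "i \<in> V" for i
  proof -
    obtain n b where b: "b \<notin> var_ideal V" "xpow (Poly_Mapping.single i 1) ^ n * b \<in> I"
      using pow[OF \<open>i \<in> V\<close>] by blast
    have "xpow (Poly_Mapping.single i 1) ^ n \<in> Q \<or> b \<in> Q"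
      by (rule Q.I_prime) (use b(2) Q in auto)
    then have "xpow (Poly_Mapping.single i 1) ^ n \<in> Q" using b(1) Q by blast
    then show ?thesis using primeideal_type_ring_pow Q by blast
  qed
  have "g \<in> Q" if g: "g \<in> var_ideal V" for g
  proof (rule terms_in_ideal[OF Q.ideal_axioms])
    fix m assume "m \<in> exponents g"
    with g obtain i where i: "i \<in> V" "expo m i \<noteq> 0" by (auto simp: var_ideal_iff)
    have "m = (m - Poly_Mapping.single i 1) + Poly_Mapping.single i 1"
      using i(2) by (intro poly_mapping_eqI)
        (auto simp: lookup_add minus_poly_mapping.rep_eq lookup_single when_def)
    moreover have "xpow (m - Poly_Mapping.single i 1) * xpow (Poly_Mapping.single i 1) \<in> Q"
      by (rule c(3)[OF var[OF i(1)]])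
    ultimately show "xpow m \<in> Q" by (simp add: mult_single)
  qed
  then show "Q = var_ideal V" using Q by blast
qed (use I primeideal_var_ideal in auto)

text \<open>
  Neither the polynomial \<open>h\<close> nor a denominator \<open>b\<close> outside the prime can raise the weight: \<open>b * h\<close>
  has a term free of the variables in \<open>V\<close>, and its product with \<open>m\<close> survives in \<open>b * h * m\<close> with the
  weight of \<open>m\<close>.
\<close>
lemma weight_bound_of_product:
  fixes J :: "('x::linorder, 'k::field) mpoly set"
  assumes loc: "\<And>m n. (\<forall>i\<in>V. expo n i = 0) \<Longrightarrow> \<phi> (n + m) = \<phi> m"
    and J: "\<And>a. a \<in> J \<Longrightarrow> \<exists>b. b \<notin> var_ideal V \<and> b * a \<in> supported {m. s \<le> \<phi> m}"
    and hm: "h * xpow m \<in> J" and h: "h \<notin> var_ideal V"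
  shows "s \<le> \<phi> m"
proof -
  obtain b where b: "b \<notin> var_ideal V" "b * (h * xpow m) \<in> supported {m. s \<le> \<phi> m}"
    using J[OF hm] by blast
  interpret primeideal "var_ideal V :: ('x, 'k) mpoly set" type_ring by (rule primeideal_var_ideal)
  have "b * h \<notin> var_ideal V" using I_prime[of b h] b(1) h by auto
  then obtain k where k: "k \<in> exponents (b * h)" "\<forall>i\<in>V. expo k i = 0"
    by (auto simp: var_ideal_iff)
  have "k + m \<in> exponents (b * h * xpow m)"
    using k(1) by (simp add: in_keys_iff lookup_mult_xpow)
  then have "s \<le> \<phi> (k + m)" using b(2) by (auto simp: supported_def mult.assoc)
  then show ?thesis using loc[OF k(2)] by simp
qed

lemma exponent_split:
  fixes a m :: "'x \<Rightarrow>\<^sub>0 nat"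
  assumes "\<And>i. expo a i \<le> expo m i"
  obtains b where "m = a + b" "\<And>i. expo b i = expo m i - expo a i"
proof -
  have "m = a + (m - a)"
    using assms by (intro poly_mapping_eqI) (simp add: lookup_add minus_poly_mapping.rep_eq)
  then show thesis by (rule that) (simp add: minus_poly_mapping.rep_eq)
qed


section \<open>An ideal with oscillating associated radicals\<close>

locale four_variables =
  fixes x y z u :: "'x::linorder"
  assumes distinct: "x \<noteq> y" "x \<noteq> z" "x \<noteq> u" "y \<noteq> z" "y \<noteq> u" "z \<noteq> u"
begin

lemmas distinct' = distinct distinct[symmetric]

definition ord_xy :: "('x \<Rightarrow>\<^sub>0 nat) \<Rightarrow> nat" where "ord_xy m = expo m x div 4 + expo m y div 4"
definition ord_zu :: "('x \<Rightarrow>\<^sub>0 nat) \<Rightarrow> nat" where "ord_zu m = expo m z div 2 + expo m u"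
definition ord_xz :: "('x \<Rightarrow>\<^sub>0 nat) \<Rightarrow> nat" where "ord_xz m = (expo m x + expo m z) div 4"
definition ord_yz :: "('x \<Rightarrow>\<^sub>0 nat) \<Rightarrow> nat" where "ord_yz m = (expo m y + expo m z) div 4"

lemmas ord_defs = ord_xy_def ord_zu_def ord_xz_def ord_yz_def

text \<open>
  The exponents of the monomials in the intersection of the four components
  \<open>(x^4, y^4)\<close>, \<open>(z^2, u)\<close>, \<open>(x, z)^4\<close> and \<open>(y, z)^4\<close>.
\<close>
definition osc_exponents :: "('x \<Rightarrow>\<^sub>0 nat) set"
  where "osc_exponents = {m. 1 \<le> ord_xy m \<and> 1 \<le> ord_zu m \<and> 1 \<le> ord_xz m \<and> 1 \<le> ord_yz m}"

definition osc_ideal :: "('x, 'k::field) mpoly set"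
  where "osc_ideal = supported osc_exponents"

definition osc_primes :: "('x, 'k::field) mpoly set set"
  where "osc_primes = {var_ideal {x, y}, var_ideal {z, u}, var_ideal {x, z}, var_ideal {y, z}}"

abbreviation pair :: "'x \<Rightarrow> 'x \<Rightarrow> nat \<Rightarrow> ('x \<Rightarrow>\<^sub>0 nat)"
  where "pair p q n \<equiv> Poly_Mapping.single p n + Poly_Mapping.single q n"

lemma div_superadditive: "(a::nat) div d + b div d \<le> (a + b) div d"
  by (cases "d = 0") (simp_all add: less_eq_div_iff_mult_less_eq algebra_simps add_mono)

lemma superadditive_ord:
  "superadditive ord_xy" "superadditive ord_zu" "superadditive ord_xz" "superadditive ord_yz"
proof -
  have h: "(a + b) div d + (a' + b') div d \<le> (a + a' + (b + b')) div d" for a b a' b' d :: nat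
    using div_superadditive[of "a + b" d "a' + b'"] by (simp add: add_ac)
  show "superadditive ord_xz" "superadditive ord_yz"
    unfolding superadditive_def ord_defs lookup_add using h by blast+
  show "superadditive ord_xy"
    unfolding superadditive_def ord_defs lookup_add
  proof (intro allI)
    fix a b :: "'x \<Rightarrow>\<^sub>0 nat"
    show "expo a x div 4 + expo a y div 4 + (expo b x div 4 + expo b y div 4)
        \<le> (expo a x + expo b x) div 4 + (expo a y + expo b y) div 4"
      using div_superadditive[of "expo a x" 4 "expo b x"] div_superadditive[of "expo a y" 4 "expo b y"]
      by linarith
  qed
  show "superadditive ord_zu"
    unfolding superadditive_def ord_defs lookup_add
  proof (intro allI)
    fix a b :: "'x \<Rightarrow>\<^sub>0 nat"
    show "expo a z div 2 + expo a u + (expo b z div 2 + expo b u)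
        \<le> (expo a z + expo b z) div 2 + (expo a u + expo b u)"
      using div_superadditive[of "expo a z" 2 "expo b z"] by linarith
  qed
qed

lemma osc_exponents_up: "m \<in> osc_exponents \<Longrightarrow> n + m \<in> osc_exponents"
  using superadditive_ord[THEN superadditive_mono, of m n] unfolding osc_exponents_def
  by (auto simp: add.commute intro: le_trans)

lemma ideal_osc_ideal: "ideal (osc_ideal :: ('x, 'k::field) mpoly set) type_ring"
  unfolding osc_ideal_def using osc_exponents_up by (rule ideal_supported)

lemma monomial_osc_ideal: "monomial_ideal (osc_ideal :: ('x, 'k::field) mpoly set)"
  unfolding osc_ideal_def using osc_exponents_up by (rule monomial_ideal_supported)

lemma osc_ideal_subset_ord:
  "osc_ideal \<subseteq> supported {m. 1 \<le> ord_xy m}" "osc_ideal \<subseteq> supported {m. 1 \<le> ord_zu m}"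
  "osc_ideal \<subseteq> supported {m. 1 \<le> ord_xz m}" "osc_ideal \<subseteq> supported {m. 1 \<le> ord_yz m}"
  by (auto simp: osc_ideal_def osc_exponents_def supported_def)

text \<open>
  For each component two variables outside its prime such that inverting them turns the other three
  components into the unit ideal; inverting \<open>x, z\<close> or \<open>y, z\<close> trivializes all four.
\<close>
lemma xpow_in_osc_ideal:
  "1 \<le> ord_xy a \<Longrightarrow> xpow (a + pair z u 4) \<in> osc_ideal"
  "1 \<le> ord_zu a \<Longrightarrow> xpow (a + pair x y 4) \<in> osc_ideal"
  "1 \<le> ord_xz a \<Longrightarrow> xpow (a + pair y u 4) \<in> osc_ideal"
  "1 \<le> ord_yz a \<Longrightarrow> xpow (a + pair x u 4) \<in> osc_ideal"
  "xpow (a + pair x z 4) \<in> osc_ideal" "xpow (a + pair y z 4) \<in> osc_ideal"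
  using distinct'
  by (auto simp: osc_ideal_def osc_exponents_def supported_def ord_defs lookup_add lookup_single when_def)

lemma osc_primes_minimal: "osc_primes \<subseteq> minimal_primes (osc_ideal :: ('x, 'k::field) mpoly set)"
proof -
  have sub: "osc_ideal \<subseteq> (P :: ('x, 'k) mpoly set)" if "P \<in> osc_primes" for P
  proof
    fix g :: "('x, 'k) mpoly" assume g: "g \<in> osc_ideal"
    have "expo m x \<noteq> 0 \<or> expo m y \<noteq> 0" "expo m z \<noteq> 0 \<or> expo m u \<noteq> 0"
      "expo m x \<noteq> 0 \<or> expo m z \<noteq> 0" "expo m y \<noteq> 0 \<or> expo m z \<noteq> 0" if "m \<in> exponents g" for m
      using g that by (auto simp: osc_ideal_def supported_def osc_exponents_def ord_defs)
    then show "g \<in> P" using \<open>P \<in> osc_primes\<close> by (auto simp: osc_primes_def var_ideal_iff)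
  qed
  have pw: "xpow (Poly_Mapping.single i 1) ^ n = xpow (Poly_Mapping.single i n)" for i :: 'x and n
    by (induction n) (simp_all add: mult_single flip: single_add)
  have prime: "var_ideal {a, b} \<in> minimal_primes (osc_ideal :: ('x, 'k) mpoly set)"
    if ab: "var_ideal {a, b} \<in> (osc_primes :: ('x, 'k) mpoly set set)" "{p, q} \<inter> {a, b} = {}"
      and mem: "xpow (Poly_Mapping.single a 4 + pair p q 4) \<in> (osc_ideal :: ('x, 'k) mpoly set)"
        "xpow (Poly_Mapping.single b 4 + pair p q 4) \<in> (osc_ideal :: ('x, 'k) mpoly set)" for a b p q
  proof (rule var_ideal_minimal_prime[OF sub[OF ab(1)]])
    fix i assume "i \<in> {a, b}"
    then have "xpow (Poly_Mapping.single i 1) ^ 4 * xpow (pair p q 4) \<in> (osc_ideal :: ('x, 'k) mpoly set)"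
      using mem unfolding pw mult_single mult_1 by blast
    moreover have "xpow (pair p q 4) \<notin> (var_ideal {a, b} :: ('x, 'k) mpoly set)"
      using ab(2) by (auto simp: xpow_in_var_ideal_iff lookup_add lookup_single when_def)
    ultimately show "\<exists>n c. c \<notin> var_ideal {a, b} \<and>
        xpow (Poly_Mapping.single i 1) ^ n * c \<in> (osc_ideal :: ('x, 'k) mpoly set)" by blast
  qed
  have ords: "1 \<le> ord_xy (Poly_Mapping.single x 4)" "1 \<le> ord_xy (Poly_Mapping.single y 4)"
    "1 \<le> ord_zu (Poly_Mapping.single z 4)" "1 \<le> ord_zu (Poly_Mapping.single u 4)"
    "1 \<le> ord_xz (Poly_Mapping.single x 4)" "1 \<le> ord_xz (Poly_Mapping.single z 4)"
    "1 \<le> ord_yz (Poly_Mapping.single y 4)" "1 \<le> ord_yz (Poly_Mapping.single z 4)"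
    using distinct' by (auto simp: ord_defs lookup_single when_def)
  have "var_ideal {x, y} \<in> minimal_primes (osc_ideal :: ('x, 'k) mpoly set)"
    by (rule prime[OF _ _ xpow_in_osc_ideal(1)[OF ords(1)] xpow_in_osc_ideal(1)[OF ords(2)]])
      (use distinct' in \<open>auto simp: osc_primes_def\<close>)
  moreover have "var_ideal {z, u} \<in> minimal_primes (osc_ideal :: ('x, 'k) mpoly set)"
    by (rule prime[OF _ _ xpow_in_osc_ideal(2)[OF ords(3)] xpow_in_osc_ideal(2)[OF ords(4)]])
      (use distinct' in \<open>auto simp: osc_primes_def\<close>)
  moreover have "var_ideal {x, z} \<in> minimal_primes (osc_ideal :: ('x, 'k) mpoly set)"
    by (rule prime[OF _ _ xpow_in_osc_ideal(3)[OF ords(5)] xpow_in_osc_ideal(3)[OF ords(6)]])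
      (use distinct' in \<open>auto simp: osc_primes_def\<close>)
  moreover have "var_ideal {y, z} \<in> minimal_primes (osc_ideal :: ('x, 'k) mpoly set)"
    by (rule prime[OF _ _ xpow_in_osc_ideal(4)[OF ords(7)] xpow_in_osc_ideal(4)[OF ords(8)]])
      (use distinct' in \<open>auto simp: osc_primes_def\<close>)
  ultimately show ?thesis by (simp add: osc_primes_def)
qed

text \<open>
  Each of these functions computes the exact order with respect to its component, so one generator
  can be split off at a time. For \<open>ord_xz\<close> and \<open>ord_yz\<close> this needs all monomials of degree \<open>4\<close> as
  generators.
\<close>
lemma ord_split:
  "Suc n \<le> ord_xy m \<Longrightarrow> \<exists>a b. m = a + b \<and> a \<in> {a. 1 \<le> ord_xy a} \<and> n \<le> ord_xy b"
  "Suc n \<le> ord_zu m \<Longrightarrow> \<exists>a b. m = a + b \<and> a \<in> {a. 1 \<le> ord_zu a} \<and> n \<le> ord_zu b"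
  "Suc n \<le> ord_xz m \<Longrightarrow> \<exists>a b. m = a + b \<and> a \<in> {a. 1 \<le> ord_xz a} \<and> n \<le> ord_xz b"
  "Suc n \<le> ord_yz m \<Longrightarrow> \<exists>a b. m = a + b \<and> a \<in> {a. 1 \<le> ord_yz a} \<and> n \<le> ord_yz b"
proof -
  have split1: "\<exists>a b. m = a + b \<and> a \<in> {a. 1 \<le> \<phi> a} \<and> n \<le> \<phi> b"
    if h: "k \<le> expo m i" "1 \<le> \<phi> (Poly_Mapping.single i k)"
      "\<And>b. (\<And>j. expo b j = expo m j - expo (Poly_Mapping.single i k) j) \<Longrightarrow> n \<le> \<phi> b" for \<phi> k i
  proof -
    obtain b where "m = Poly_Mapping.single i k + b"
      "\<And>j. expo b j = expo m j - expo (Poly_Mapping.single i k) j"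
      by (rule exponent_split[of "Poly_Mapping.single i k" m])
        (use h(1) in \<open>auto simp: lookup_single when_def\<close>)
    then show ?thesis using h(2,3) by blast
  qed
  show "\<exists>a b. m = a + b \<and> a \<in> {a. 1 \<le> ord_xy a} \<and> n \<le> ord_xy b" if h: "Suc n \<le> ord_xy m"
  proof (cases "4 \<le> expo m x")
    case True
    then show ?thesis using h distinct'
      by (intro split1[of 4 x ord_xy]) (auto simp: ord_defs lookup_single when_def)
  next
    case False
    then have "4 \<le> expo m y" using h by (simp add: ord_defs)
    then show ?thesis using h distinct' False
      by (intro split1[of 4 y ord_xy]) (auto simp: ord_defs lookup_single when_def)
  qed
  show "\<exists>a b. m = a + b \<and> a \<in> {a. 1 \<le> ord_zu a} \<and> n \<le> ord_zu b" if h: "Suc n \<le> ord_zu m"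
  proof (cases "2 \<le> expo m z")
    case True
    then show ?thesis using h distinct'
      by (intro split1[of 2 z ord_zu]) (auto simp: ord_defs lookup_single when_def)
  next
    case False
    then have "1 \<le> expo m u" using h by (simp add: ord_defs)
    then show ?thesis using h distinct' False
      by (intro split1[of 1 u ord_zu]) (auto simp: ord_defs lookup_single when_def)
  qed
  have split2: "\<exists>a b. m = a + b \<and> a \<in> {a. 1 \<le> (expo a p + expo a q) div 4} \<and> n \<le> (expo b p + expo b q) div 4"
    if h: "Suc n \<le> (expo m p + expo m q) div 4" and pq: "p \<noteq> q" for p q
  proof -
    define c where "c = min 4 (expo m p)"
    let ?a = "Poly_Mapping.single p c + Poly_Mapping.single q (4 - c)"
    have le: "c \<le> 4" "c \<le> expo m p" "4 - c \<le> expo m q" using h by (auto simp: c_def)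
    obtain b where b: "m = ?a + b" "\<And>j. expo b j = expo m j - expo ?a j"
      by (rule exponent_split[of ?a m]) (use le pq in \<open>auto simp: lookup_add lookup_single when_def\<close>)
    have "1 \<le> (expo ?a p + expo ?a q) div 4" using pq le(1) by (auto simp: lookup_add lookup_single when_def)
    moreover have "n \<le> (expo b p + expo b q) div 4"
      using h le pq by (auto simp: b(2) lookup_add lookup_single when_def)
    ultimately show ?thesis using b(1) by blast
  qed
  show "Suc n \<le> ord_xz m \<Longrightarrow> \<exists>a b. m = a + b \<and> a \<in> {a. 1 \<le> ord_xz a} \<and> n \<le> ord_xz b"
    using split2[of x z] distinct unfolding ord_defs by blast
  show "Suc n \<le> ord_yz m \<Longrightarrow> \<exists>a b. m = a + b \<and> a \<in> {a. 1 \<le> ord_yz a} \<and> n \<le> ord_yz b"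
    using split2[of y z] distinct unfolding ord_defs by blast
qed

lemma xpow_in_osc_power:
  "s \<le> ord_xy m \<Longrightarrow> xpow (m + pair z u (4 * s)) \<in> ideal_power (osc_ideal :: ('x, 'k::field) mpoly set) s"
  "s \<le> ord_zu m \<Longrightarrow> xpow (m + pair x y (4 * s)) \<in> ideal_power (osc_ideal :: ('x, 'k::field) mpoly set) s"
  "s \<le> ord_xz m \<Longrightarrow> xpow (m + pair y u (4 * s)) \<in> ideal_power (osc_ideal :: ('x, 'k::field) mpoly set) s"
  "s \<le> ord_yz m \<Longrightarrow> xpow (m + pair x u (4 * s)) \<in> ideal_power (osc_ideal :: ('x, 'k::field) mpoly set) s"
  "xpow (m + pair x z (4 * s)) \<in> ideal_power (osc_ideal :: ('x, 'k::field) mpoly set) s"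
  "xpow (m + pair y z (4 * s)) \<in> ideal_power (osc_ideal :: ('x, 'k::field) mpoly set) s"
proof -
  \<comment> \<open>When all components become trivial no condition on \<open>m\<close> is left: the weight is constant.\<close>
  have triv: "\<exists>a b. m = a + b \<and> a \<in> UNIV \<and> n \<le> (\<lambda>_. s) b" if "Suc n \<le> (\<lambda>_. s) m"
    for m :: "'x \<Rightarrow>\<^sub>0 nat" and n
    using that by (intro exI[of _ m] exI[of _ 0]) simp
  show "s \<le> ord_xy m \<Longrightarrow> xpow (m + pair z u (4 * s)) \<in> ideal_power (osc_ideal :: ('x, 'k) mpoly set) s"
    by (rule xpow_in_ideal_power[OF ideal_osc_ideal ord_split(1)]) (auto intro: xpow_in_osc_ideal)
  show "s \<le> ord_zu m \<Longrightarrow> xpow (m + pair x y (4 * s)) \<in> ideal_power (osc_ideal :: ('x, 'k) mpoly set) s"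
    by (rule xpow_in_ideal_power[OF ideal_osc_ideal ord_split(2)]) (auto intro: xpow_in_osc_ideal)
  show "s \<le> ord_xz m \<Longrightarrow> xpow (m + pair y u (4 * s)) \<in> ideal_power (osc_ideal :: ('x, 'k) mpoly set) s"
    by (rule xpow_in_ideal_power[OF ideal_osc_ideal ord_split(3)]) (auto intro: xpow_in_osc_ideal)
  show "s \<le> ord_yz m \<Longrightarrow> xpow (m + pair x u (4 * s)) \<in> ideal_power (osc_ideal :: ('x, 'k) mpoly set) s"
    by (rule xpow_in_ideal_power[OF ideal_osc_ideal ord_split(4)]) (auto intro: xpow_in_osc_ideal)
  show "xpow (m + pair x z (4 * s)) \<in> ideal_power (osc_ideal :: ('x, 'k) mpoly set) s"
    by (rule xpow_in_ideal_power[OF ideal_osc_ideal triv]) (auto intro: xpow_in_osc_ideal)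
  show "xpow (m + pair y z (4 * s)) \<in> ideal_power (osc_ideal :: ('x, 'k) mpoly set) s"
    by (rule xpow_in_ideal_power[OF ideal_osc_ideal triv]) (auto intro: xpow_in_osc_ideal)
qed

text \<open>
  What the ordinary and the symbolic power have in common: both contain the ordinary power and agree
  with it after localization at the four minimal primes.
\<close>
definition locally_osc_power :: "nat \<Rightarrow> ('x, 'k::field) mpoly set \<Rightarrow> bool"
  where "locally_osc_power s J \<longleftrightarrow> ideal_power osc_ideal s \<subseteq> J \<and>
    (\<forall>P\<in>osc_primes. \<forall>a\<in>J. \<exists>b. b \<notin> P \<and> b * a \<in> ideal_power osc_ideal s)"

lemma locally_osc_power_ideal_power:
  "locally_osc_power s (ideal_power (osc_ideal :: ('x, 'k::field) mpoly set) s)"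
proof -
  have "(1 :: ('x, 'k) mpoly) \<notin> P" if "P \<in> osc_primes" for P
    using that by (auto simp: osc_primes_def var_ideal_iff)
  then show ?thesis unfolding locally_osc_power_def by (metis mult_1 subset_refl)
qed

lemma locally_osc_power_symbolic_power:
  "locally_osc_power s (symbolic_power (osc_ideal :: ('x, 'k::field) mpoly set) s)"
  unfolding locally_osc_power_def
proof (intro conjI ballI ideal_power_subset_symbolic_power)
  fix P :: "('x, 'k) mpoly set" and a assume "P \<in> osc_primes" "a \<in> symbolic_power (osc_ideal :: ('x, 'k) mpoly set) s"
  then show "\<exists>b. b \<notin> P \<and> b * a \<in> ideal_power osc_ideal s"
    using symbolic_powerD[OF ideal_osc_ideal, of P a s] osc_primes_minimal by blast
qed

lemma ord_bound_of_product:
  fixes J :: "('x, 'k::field) mpoly set"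
  assumes J: "locally_osc_power s J" and hm: "h * xpow m \<in> J"
  shows "h \<notin> var_ideal {x, y} \<Longrightarrow> s \<le> ord_xy m" "h \<notin> var_ideal {z, u} \<Longrightarrow> s \<le> ord_zu m"
    "h \<notin> var_ideal {x, z} \<Longrightarrow> s \<le> ord_xz m" "h \<notin> var_ideal {y, z} \<Longrightarrow> s \<le> ord_yz m"
proof -
  have loc: "\<exists>b. b \<notin> P \<and> b * a \<in> supported {m. s \<le> \<phi> m}"
    if "P \<in> osc_primes" "superadditive \<phi>" "osc_ideal \<subseteq> (supported {m. 1 \<le> \<phi> m} :: ('x, 'k) mpoly set)" "a \<in> J"
    for P \<phi> a
    using J that ideal_power_supported_subset[OF that(2,3), of s] unfolding locally_osc_power_def by blast
  show "h \<notin> var_ideal {x, y} \<Longrightarrow> s \<le> ord_xy m"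
    by (rule weight_bound_of_product[OF _ loc[OF _ superadditive_ord(1) osc_ideal_subset_ord(1)] hm])
      (auto simp: ord_defs lookup_add osc_primes_def)
  show "h \<notin> var_ideal {z, u} \<Longrightarrow> s \<le> ord_zu m"
    by (rule weight_bound_of_product[OF _ loc[OF _ superadditive_ord(2) osc_ideal_subset_ord(2)] hm])
      (auto simp: ord_defs lookup_add osc_primes_def)
  show "h \<notin> var_ideal {x, z} \<Longrightarrow> s \<le> ord_xz m"
    by (rule weight_bound_of_product[OF _ loc[OF _ superadditive_ord(3) osc_ideal_subset_ord(3)] hm])
      (auto simp: ord_defs lookup_add osc_primes_def)
  show "h \<notin> var_ideal {y, z} \<Longrightarrow> s \<le> ord_yz m"
    by (rule weight_bound_of_product[OF _ loc[OF _ superadditive_ord(4) osc_ideal_subset_ord(4)] hm])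
      (auto simp: ord_defs lookup_add osc_primes_def)
qed

definition osc_radical :: "('x, 'k::field) mpoly set"
  where "osc_radical = var_ideal {x, y} \<inter> var_ideal {z, u}"

text \<open>
  For odd \<open>s\<close> the exponent \<open>2 s + 1\<close> is \<open>3\<close> modulo \<open>4\<close>, so rounding both \<open>x\<close>- and \<open>y\<close>-exponent down
  to multiples of \<open>4\<close> costs \<open>6\<close> and brings their sum \<open>4 s + 2\<close> below \<open>4 s\<close>.
\<close>
lemma osc_radical_in_assrad:
  fixes J :: "('x, 'k::field) mpoly set"
  assumes s: "odd s" and J: "locally_osc_power s J"
  shows "osc_radical \<in> assrad J"
proof -
  define f :: "'x \<Rightarrow>\<^sub>0 nat" where "f = Poly_Mapping.single x (2 * s + 1) +
    Poly_Mapping.single y (2 * s + 1) + Poly_Mapping.single z (2 * s - 1)"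
  have f: "expo f x = 2 * s + 1" "expo f y = 2 * s + 1" "expo f z = 2 * s - 1" "expo f u = 0"
    using distinct' by (simp_all add: f_def lookup_add lookup_single when_def)
  obtain t where t: "s = 2 * t + 1" using s by (rule oddE)
  have ords: "\<not> s \<le> ord_xy f" "\<not> s \<le> ord_zu f" "s \<le> ord_xz f" "s \<le> ord_yz f"
    unfolding ord_defs f t by presburger+
  have notin: "xpow f \<notin> J"
    using ord_bound_of_product(1)[OF J, of 1 f] ords(1) by (auto simp: var_ideal_iff)
  have "radical (colon J (xpow f)) = osc_radical"
  proof (intro equalityI subsetI)
    fix g assume "g \<in> radical (colon J (xpow f))"
    then obtain n where "g ^ n * xpow f \<in> J" by (auto simp: radical_def colon_def)
    then have "g ^ n \<in> var_ideal {x, y}" "g ^ n \<in> var_ideal {z, u}"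
      using ord_bound_of_product(1,2)[OF J] ords(1,2) by blast+
    then show "g \<in> osc_radical"
      unfolding osc_radical_def using primeideal_type_ring_pow[OF primeideal_var_ideal] by blast
  next
    fix g :: "('x, 'k) mpoly" assume g: "g \<in> osc_radical"
    \<comment> \<open>The order of a monomial with respect to the radical: terms of a high power of \<open>g\<close> contain
      high powers of one of \<open>x, y\<close> and of one of \<open>z, u\<close>.\<close>
    define \<tau> where "\<tau> m = min (expo m x + expo m y) (expo m z + expo m u)" for m :: "'x \<Rightarrow>\<^sub>0 nat"
    have \<tau>: "superadditive \<tau>" by (auto simp: superadditive_def \<tau>_def lookup_add)
    have g1: "1 \<le> \<tau> m" if "m \<in> exponents g" for m
      using g that by (fastforce simp: osc_radical_def var_ideal_iff \<tau>_def)
    have I: "ideal (ideal_power (osc_ideal :: ('x, 'k) mpoly set) s) type_ring"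
      by (rule ideal_ideal_power[OF ideal_osc_ideal])
    have up: "xpow (m + f) \<in> ideal_power (osc_ideal :: ('x, 'k) mpoly set) s"
      if h: "xpow (f + pair p q (4 * s)) \<in> ideal_power (osc_ideal :: ('x, 'k) mpoly set) s"
        "p \<noteq> q" "4 * s \<le> expo m p" "4 * s \<le> expo m q" for m p q
    proof -
      obtain b where "m = pair p q (4 * s) + b"
        by (rule exponent_split[of "pair p q (4 * s)" m])
          (use h in \<open>auto simp: lookup_add lookup_single when_def\<close>)
      then have "m + f = b + (f + pair p q (4 * s))" by (simp add: add_ac)
      then show ?thesis using ideal_type_ringD(3)[OF I h(1), of "xpow b"] by (simp add: mult_single)
    qed
    have "xpow (m + f) \<in> ideal_power (osc_ideal :: ('x, 'k) mpoly set) s"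
      if "m \<in> exponents (g ^ (8 * s))" for m
    proof -
      have "8 * s \<le> \<tau> m" by (rule power_exponents[OF \<tau> g1 that])
      then consider "4 * s \<le> expo m x" "4 * s \<le> expo m z" | "4 * s \<le> expo m y" "4 * s \<le> expo m z"
        | "4 * s \<le> expo m x" "4 * s \<le> expo m u" | "4 * s \<le> expo m y" "4 * s \<le> expo m u"
        unfolding \<tau>_def by linarith
      then show ?thesis
        using up[OF xpow_in_osc_power(5)] up[OF xpow_in_osc_power(6)]
          up[OF xpow_in_osc_power(4)[OF ords(4)]] up[OF xpow_in_osc_power(3)[OF ords(3)]]
          distinct by cases auto
    qed
    then have "g ^ (8 * s) * xpow f \<in> ideal_power osc_ideal s"
      using keys_mult[of "g ^ (8 * s)" "xpow f"] by - (rule terms_in_ideal[OF I], auto)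
    moreover have "0 < 8 * s" using t by simp
    ultimately show "g \<in> radical (colon J (xpow f))"
      using J unfolding radical_def colon_def locally_osc_power_def by blast
  qed
  then show ?thesis using notin unfolding assrad_def monomials_def by blast
qed

text \<open>
  Membership of \<open>x u\<close> and \<open>y u\<close> in the radical bounds \<open>ord_yz\<close> and \<open>ord_xz\<close> of \<open>f\<close> from below, and
  non-membership of powers of \<open>z u\<close> and \<open>x y\<close> bounds \<open>ord_xy\<close> and \<open>ord_zu\<close> from above. For even \<open>s\<close>
  the four bounds contradict each other.
\<close>
lemma osc_radical_notin_assrad:
  fixes J :: "('x, 'k::field) mpoly set"
  assumes s: "even s" and J: "locally_osc_power s J"
  shows "osc_radical \<notin> assrad J"
proof
  assume "osc_radical \<in> assrad J"
  then obtain f where rad: "osc_radical = radical (colon J (xpow f))"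
    by (auto simp: assrad_def monomials_def)
  have sub: "ideal_power osc_ideal s \<subseteq> J" using J by (simp add: locally_osc_power_def)
  have prod: "\<exists>n. xpow (pair p q 1) ^ n * xpow f \<in> J" if "p \<in> {x, y}" "q \<in> {z, u}" for p q
  proof -
    have "xpow (pair p q 1) \<in> (osc_radical :: ('x, 'k) mpoly set)"
      using that distinct' by (auto simp: osc_radical_def xpow_in_var_ideal_iff lookup_add)
    then show ?thesis unfolding rad radical_def colon_def by blast
  qed
  have notpow: "xpow (pair p q 1) ^ n \<notin> (var_ideal V :: ('x, 'k) mpoly set)" if "p \<notin> V" "q \<notin> V" for p q n V
  proof -
    have "xpow (pair p q 1) \<notin> (var_ideal V :: ('x, 'k) mpoly set)"
      using that by (auto simp: xpow_in_var_ideal_iff lookup_add lookup_single when_def)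
    then show ?thesis using primeideal_type_ring_pow[OF primeideal_var_ideal] by blast
  qed
  have xz: "s \<le> ord_xz f"
    using prod[of y u] ord_bound_of_product(3)[OF J _ notpow] distinct' by blast
  have yz: "s \<le> ord_yz f"
    using prod[of x u] ord_bound_of_product(4)[OF J _ notpow] distinct' by blast
  have colon: "g \<in> osc_radical" if "g * xpow f \<in> ideal_power osc_ideal s" for g :: "('x, 'k) mpoly"
    unfolding rad radical_def colon_def using that sub by (intro CollectI exI[of _ 1]) auto
  have xy: "\<not> s \<le> ord_xy f"
  proof
    assume "s \<le> ord_xy f"
    then have "xpow (pair z u (4 * s)) \<in> (osc_radical :: ('x, 'k) mpoly set)"
      by (intro colon) (use xpow_in_osc_power(1)[of s f] in \<open>simp add: mult_single add.commute\<close>)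
    then show False using distinct'
      by (auto simp: osc_radical_def xpow_in_var_ideal_iff lookup_add lookup_single when_def)
  qed
  have zu: "\<not> s \<le> ord_zu f"
  proof
    assume "s \<le> ord_zu f"
    then have "xpow (pair x y (4 * s)) \<in> (osc_radical :: ('x, 'k) mpoly set)"
      by (intro colon) (use xpow_in_osc_power(2)[of s f] in \<open>simp add: mult_single add.commute\<close>)
    then show False using distinct'
      by (auto simp: osc_radical_def xpow_in_var_ideal_iff lookup_add lookup_single when_def)
  qed
  obtain t where t: "s = 2 * t" using s by (rule evenE)
  have "expo f z div 2 < 2 * t" using zu by (simp add: ord_zu_def t)
  then have "expo f z < 4 * t" by simp
  moreover have "8 * t \<le> expo f x + expo f z" using xz by (simp add: ord_xz_def t)
  moreover have "8 * t \<le> expo f y + expo f z" using yz by (simp add: ord_yz_def t)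
  ultimately have "t \<le> expo f x div 4" "t \<le> expo f y div 4" by simp_all
  then show False using xy by (simp add: ord_xy_def t)
qed

lemma assrad_not_eventually_constant:
  fixes J :: "nat \<Rightarrow> ('x, 'k::field) mpoly set"
  assumes J: "\<And>s. locally_osc_power s (J s)"
  shows "\<not> (\<exists>s0\<ge>1. \<forall>s\<ge>s0. assrad (J s) = assrad (J s0))"
proof
  assume "\<exists>s0\<ge>1. \<forall>s\<ge>s0. assrad (J s) = assrad (J s0)"
  then obtain s0 where "\<forall>s\<ge>s0. assrad (J s) = assrad (J s0)" by blast
  then have "assrad (J (Suc s0)) = assrad (J s0)" by (rule allE[of _ "Suc s0"]) simp
  then show False
    using osc_radical_in_assrad[OF _ J] osc_radical_notin_assrad[OF _ J] by (cases "even s0") (metis even_Suc)+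
qed

end

theorem theorem1:
  shows "\<exists>I :: (5, 'k::field) mpoly set. monomial_ideal I \<and>
    \<not> (\<exists>s0\<ge>1. \<forall>s\<ge>s0. assrad (symbolic_power I s) = assrad (symbolic_power I s0)) \<and>
    \<not> (\<exists>s0\<ge>1. \<forall>s\<ge>s0. assrad (ideal_power I s) = assrad (ideal_power I s0))"
proof -
  interpret four_variables "0 :: 5" 1 2 3 by standard simp_all
  show ?thesis
    by (intro exI[of _ osc_ideal] conjI monomial_osc_ideal assrad_not_eventually_constant
        locally_osc_power_symbolic_power locally_osc_power_ideal_power)
qed

end
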